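(* Let $P$ be a normal fuzzy logic program over a complete lattice $(V,\leqslant)$ and a set of atoms $\Pi$, and let $I\colon\Pi\to V$ be an interpretation. Then $(I,I)$ is an AFT stable model of $P$, i.e. $\mathcal{T}_P^{\mathit{st}}(I,I)=(I,I)$, if and only if $I$ is a stable model of $P$ in the reduct sense, i.e. $I$ is the least model of the reduct $P_I$.
   Context: Setting. $(V,\leqslant)$ is a complete lattice of truth values with least element $0$ and greatest element $1$; $V'\subseteq V$ is a designated subset of truth values allowed as constants and weights; $\Pi$ is a set of atoms. Each $n$-ary connective $f$ has a truth function $f^{\cdot}\colon V^n\to V$. Truth functions of conjunctors, disjunctors and aggregators are monotone in each argument; a conjunctor $\&$ satisfies $x\mathbin{\&^{\cdot}}y\leqslant x$, $x\mathbin{\&^{\cdot}}y\leqslant y$, $x\mathbin{\&^{\cdot}}1=x=1\mathbin{\&^{\cdot}}x$; a disjunctor $|$ satisfies $x\leqslant x\mathbin{|^{\cdot}}y$, $y\leqslant x\mathbin{|^{\cdot}}y$, $x\mathbin{|^{\cdot}}0=x=0\mathbin{|^{\cdot}}x$. The truth function of an implicator is monotone in its first and antimonotone in its second argument. No associativity, commutativity or continuity is assumed. Each implicator $\leftarrow_i$ is paired with a conjunctor $\wedge_i$ forming an adjoint pair: for all $x,y,z\in V$, $y\wedge_i^{\cdot}x\leqslant z$ iff $y\leqslant z\leftarrow_i^{\cdot}x$. Default negation $\sim$ has a truth function $\sim^{\cdot}\colon V\to V$ that is an antimonotone involution. Normal fuzzy formulas are built from constants $c\in V'$, atoms $p$ and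 negated atoms $\sim p$ ($p\in\Pi$) using conjunctors, disjunctors and aggregators. A normal fuzzy logic program $P$ is a finite set of rules $p\leftarrow_i^{\vartheta}\mathcal{B}$ with head $p\in\Pi$, weight $\vartheta\in V'$ and body $\mathcal{B}$ a normal fuzzy formula. Interpretations are functions $I\colon\Pi\to V$, ordered pointwise; $\mathcal{I}$ is the complete lattice of all of them. $\hat I(\varphi)$ is the truth-functional evaluation of $\varphi$ under $I$. An interpretation $I$ satisfies $p\leftarrow_i^{\vartheta}\mathcal{B}$ iff $\vartheta\leqslant I(p)\leftarrow_i^{\cdot}\hat I(\mathcal{B})$; $I$ is a model of a program iff it satisfies all its rules. Reduct: for an interpretation $I$ and a rule $p\leftarrow_i^{\vartheta}\mathcal{B}$, let $\mathcal{B}_I$ be the positive formula obtained from $\mathcal{B}$ by evaluating every negated atom $\sim q$ to the fixed truth value $\sim^{\cdot}I(q)$ and keeping all positive atoms; $P_I=\{p\leftarrow_i^{\vartheta}\mathcal{B}_I : p\leftarrow_i^{\vartheta}\mathcal{B}\in P\}$. (The truth values introduced this way need not lie in $V'$.) Evaluation under a pair $(L,U)\in\mathcal{I}^2$: $\widehat{(L,U)}(c)=c$, $\widehat{(L,U)}(p)=L(p)$, $\widehat{(L,U)}(\sim p)=\sim^{\cdot}U(p)$, and $\widehat{(L,U)}(f(\varphi_1,\dots,\varphi_n))=f^{\cdot}(\widehat{(L,U)}(\varphi_1),\dots,\widehat{(L,U)}(\varphi_n))$. The operator $\mathcal{T}_P\colon\mathcal{I}^2\to\mathcal{I}^2$ is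 given by $\mathcal{T}_P(L,U)_1(p)=\bigvee\{\vartheta\wedge_i^{\cdot}\widehat{(L,U)}(\mathcal{B}) : p\leftarrow_i^{\vartheta}\mathcal{B}\in P\}$ and $\mathcal{T}_P(L,U)_2=\mathcal{T}_P(U,L)_1$ (subscripts $1,2$ denote components). Its stable operator is $\mathcal{T}_P^{\mathit{st}}(L,U)=(\mathit{lfp}(\mathcal{T}_P(\cdot,U)_1),\mathit{lfp}(\mathcal{T}_P(L,\cdot)_2))$, least fixpoints of monotone operators on $\mathcal{I}$. *)

theory Defs
  imports Main
begin

text \<open>
  A single type \<open>'s\<close> of connective symbols carries the (possibly empty) sets of
  conjunctors, disjunctors, aggregators and implicators; an \<open>n\<close>-ary truth function is
  a function on lists of which only the values on lists of length \<open>n\<close> matter.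
  The set \<open>designated\<close> holds the truth values allowed as constants and weights, and
  \<open>adj i\<close> is the conjunctor paired with the implicator \<open>i\<close>.
\<close>

record ('s, 'v) fuzzy_language =
  conjunctors :: "'s set"
  disjunctors :: "'s set"
  aggregators :: "'s set"
  implicators :: "'s set"
  arity :: "'s \<Rightarrow> nat"
  truth_fun :: "'s \<Rightarrow> 'v list \<Rightarrow> 'v"
  adj :: "'s \<Rightarrow> 's"
  neg :: "'v \<Rightarrow> 'v"
  designated :: "'v set"

definition mono_in_each_arg :: "nat \<Rightarrow> ('v::order list \<Rightarrow> 'v) \<Rightarrow> bool" where
  "mono_in_each_arg n g \<longleftrightarrow>
     (\<forall>xs i. length xs = n \<and> i < n \<longrightarrow> mono (\<lambda>x. g (xs[i := x])))"

locale fuzzy_logic =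
  fixes F :: "('s, 'v::complete_lattice) fuzzy_language"
  assumes conjunctor_arity: "c \<in> conjunctors F \<Longrightarrow> arity F c = 2"
    and conjunctor_mono: "c \<in> conjunctors F \<Longrightarrow> mono_in_each_arg 2 (truth_fun F c)"
    and conjunctor_le1: "c \<in> conjunctors F \<Longrightarrow> truth_fun F c [x, y] \<le> x"
    and conjunctor_le2: "c \<in> conjunctors F \<Longrightarrow> truth_fun F c [x, y] \<le> y"
    and conjunctor_top_right: "c \<in> conjunctors F \<Longrightarrow> truth_fun F c [x, top] = x"
    and conjunctor_top_left: "c \<in> conjunctors F \<Longrightarrow> truth_fun F c [top, x] = x"
    and disjunctor_arity: "d \<in> disjunctors F \<Longrightarrow> arity F d = 2"
    and disjunctor_mono: "d \<in> disjunctors F \<Longrightarrow> mono_in_each_arg 2 (truth_fun F d)"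
    and disjunctor_ge1: "d \<in> disjunctors F \<Longrightarrow> x \<le> truth_fun F d [x, y]"
    and disjunctor_ge2: "d \<in> disjunctors F \<Longrightarrow> y \<le> truth_fun F d [x, y]"
    and disjunctor_bot_right: "d \<in> disjunctors F \<Longrightarrow> truth_fun F d [x, bot] = x"
    and disjunctor_bot_left: "d \<in> disjunctors F \<Longrightarrow> truth_fun F d [bot, x] = x"
    and aggregator_mono: "a \<in> aggregators F \<Longrightarrow> mono_in_each_arg (arity F a) (truth_fun F a)"
    and implicator_arity: "i \<in> implicators F \<Longrightarrow> arity F i = 2"
    and implicator_mono: "i \<in> implicators F \<Longrightarrow> mono (\<lambda>z. truth_fun F i [z, x])"
    and implicator_antimono: "i \<in> implicators F \<Longrightarrow> antimono (\<lambda>x. truth_fun F i [z, x])"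
    and adj_conjunctor: "i \<in> implicators F \<Longrightarrow> adj F i \<in> conjunctors F"
    and adjoint: "i \<in> implicators F \<Longrightarrow>
          truth_fun F (adj F i) [y, x] \<le> z \<longleftrightarrow> y \<le> truth_fun F i [z, x]"
    and neg_antimono: "antimono (neg F)"
    and neg_involution: "neg F (neg F x) = x"

datatype ('s, 'v, 'a) formula =
    Const 'v
  | Atom 'a
  | NegAtom 'a
  | App 's "('s, 'v, 'a) formula list"

text \<open>\<open>Rule i w p B\<close> is the rule with implicator \<open>i\<close>, weight \<open>w\<close>, head \<open>p\<close> and body \<open>B\<close>.\<close>

datatype ('s, 'v, 'a) rule =
  Rule (implicator: 's) (weight: 'v) (head: 'a) (body: "('s, 'v, 'a) formula")

inductive normal_formula :: "('s, 'v) fuzzy_language \<Rightarrow> ('s, 'v, 'a) formula \<Rightarrow> bool"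
  for F where
  "c \<in> designated F \<Longrightarrow> normal_formula F (Const c)"
| "normal_formula F (Atom p)"
| "normal_formula F (NegAtom p)"
| "\<lbrakk>f \<in> conjunctors F \<union> disjunctors F \<union> aggregators F; length \<phi>s = arity F f;
    \<forall>\<phi>\<in>set \<phi>s. normal_formula F \<phi>\<rbrakk> \<Longrightarrow> normal_formula F (App f \<phi>s)"

definition normal_program :: "('s, 'v) fuzzy_language \<Rightarrow> ('s, 'v, 'a) rule set \<Rightarrow> bool" where
  "normal_program F P \<longleftrightarrow> finite P \<and>
     (\<forall>r\<in>P. implicator r \<in> implicators F \<and> weight r \<in> designated F \<and>
            normal_formula F (body r))"

primrec eval :: "('s, 'v) fuzzy_language \<Rightarrow> ('a \<Rightarrow> 'v) \<Rightarrow> ('s, 'v, 'a) formula \<Rightarrow> 'v" where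
  "eval F I (Const c) = c"
| "eval F I (Atom p) = I p"
| "eval F I (NegAtom p) = neg F (I p)"
| "eval F I (App f \<phi>s) = truth_fun F f (map (eval F I) \<phi>s)"

definition satisfies ::
    "('s, 'v::complete_lattice) fuzzy_language \<Rightarrow> ('a \<Rightarrow> 'v) \<Rightarrow> ('s, 'v, 'a) rule \<Rightarrow> bool" where
  "satisfies F I r \<longleftrightarrow>
     weight r \<le> truth_fun F (implicator r) [I (head r), eval F I (body r)]"

definition is_model ::
    "('s, 'v::complete_lattice) fuzzy_language \<Rightarrow> ('s, 'v, 'a) rule set \<Rightarrow> ('a \<Rightarrow> 'v) \<Rightarrow> bool" where
  "is_model F P I \<longleftrightarrow> (\<forall>r\<in>P. satisfies F I r)"

definition is_least_model ::
    "('s, 'v::complete_lattice) fuzzy_language \<Rightarrow> ('s, 'v, 'a) rule set \<Rightarrow> ('a \<Rightarrow> 'v) \<Rightarrow> bool" where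
  "is_least_model F P I \<longleftrightarrow> is_model F P I \<and> (\<forall>J. is_model F P J \<longrightarrow> I \<le> J)"

text \<open>The constants introduced by the reduct need not be designated.\<close>

primrec reduct_formula ::
    "('s, 'v) fuzzy_language \<Rightarrow> ('a \<Rightarrow> 'v) \<Rightarrow> ('s, 'v, 'a) formula \<Rightarrow> ('s, 'v, 'a) formula" where
  "reduct_formula F I (Const c) = Const c"
| "reduct_formula F I (Atom p) = Atom p"
| "reduct_formula F I (NegAtom p) = Const (neg F (I p))"
| "reduct_formula F I (App f \<phi>s) = App f (map (reduct_formula F I) \<phi>s)"

definition reduct ::
    "('s, 'v) fuzzy_language \<Rightarrow> ('s, 'v, 'a) rule set \<Rightarrow> ('a \<Rightarrow> 'v) \<Rightarrow> ('s, 'v, 'a) rule set" where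
  "reduct F P I =
     (\<lambda>r. Rule (implicator r) (weight r) (head r) (reduct_formula F I (body r))) ` P"

definition reduct_stable_model ::
    "('s, 'v::complete_lattice) fuzzy_language \<Rightarrow> ('s, 'v, 'a) rule set \<Rightarrow> ('a \<Rightarrow> 'v) \<Rightarrow> bool" where
  "reduct_stable_model F P I \<longleftrightarrow> is_least_model F (reduct F P I) I"

primrec eval_pair ::
    "('s, 'v) fuzzy_language \<Rightarrow> ('a \<Rightarrow> 'v) \<times> ('a \<Rightarrow> 'v) \<Rightarrow> ('s, 'v, 'a) formula \<Rightarrow> 'v" where
  "eval_pair F LU (Const c) = c"
| "eval_pair F LU (Atom p) = fst LU p"
| "eval_pair F LU (NegAtom p) = neg F (snd LU p)"
| "eval_pair F LU (App f \<phi>s) = truth_fun F f (map (eval_pair F LU) \<phi>s)"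

definition T_lower ::
    "('s, 'v::complete_lattice) fuzzy_language \<Rightarrow> ('s, 'v, 'a) rule set \<Rightarrow>
     ('a \<Rightarrow> 'v) \<times> ('a \<Rightarrow> 'v) \<Rightarrow> 'a \<Rightarrow> 'v" where
  "T_lower F P LU p =
     Sup {truth_fun F (adj F i) [w, eval_pair F LU B] | i w B. Rule i w p B \<in> P}"

definition T_op ::
    "('s, 'v::complete_lattice) fuzzy_language \<Rightarrow> ('s, 'v, 'a) rule set \<Rightarrow>
     ('a \<Rightarrow> 'v) \<times> ('a \<Rightarrow> 'v) \<Rightarrow> ('a \<Rightarrow> 'v) \<times> ('a \<Rightarrow> 'v)" where
  "T_op F P = (\<lambda>(L, U). (T_lower F P (L, U), T_lower F P (U, L)))"

definition T_stable ::
    "('s, 'v::complete_lattice) fuzzy_language \<Rightarrow> ('s, 'v, 'a) rule set \<Rightarrow>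
     ('a \<Rightarrow> 'v) \<times> ('a \<Rightarrow> 'v) \<Rightarrow> ('a \<Rightarrow> 'v) \<times> ('a \<Rightarrow> 'v)" where
  "T_stable F P = (\<lambda>(L, U).
     (lfp (\<lambda>X. fst (T_op F P (X, U))), lfp (\<lambda>Y. snd (T_op F P (L, Y)))))"

definition aft_stable_model ::
    "('s, 'v::complete_lattice) fuzzy_language \<Rightarrow> ('s, 'v, 'a) rule set \<Rightarrow>
     ('a \<Rightarrow> 'v) \<times> ('a \<Rightarrow> 'v) \<Rightarrow> bool" where
  "aft_stable_model F P LU \<longleftrightarrow> T_stable F P LU = LU"

end

(*
  By adjointness, J satisfies a rule of the reduct P_I exactly when the value the rule
  contributes to T_P(J, I)_1 is at most J(head). So the models of P_I are the prefixpoints of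
  the monotone operator T_P(-, I)_1, and the least one is its least fixpoint (Knaster-Tarski).
  At (I, I) both components of the stable operator are this least fixpoint.
*)

theory Submission
  imports Defs
begin

text \<open>Joint monotonicity follows by passing from \<open>xs\<close> to \<open>ys\<close> one
  coordinate at a time, through the hybrids \<open>take k ys @ drop k xs\<close>.\<close>

lemma mono_in_each_arg_list_all2:
  assumes mono: "mono_in_each_arg n g" and le: "list_all2 (\<le>) xs ys" and len: "length xs = n"
  shows "g xs \<le> g ys"
proof -
  have len': "length ys = n"
    using le len by (simp add: list_all2_lengthD)
  have "g xs \<le> g (take k ys @ drop k xs)" if "k \<le> n" for k
    using that
  proof (induction k)
    case 0
    show ?case by simp
  next
    case (Suc k)
    let ?zs = "take k ys @ drop k xs"
    have k: "k < length xs" "k < length ys"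
      using Suc.prems len len' by simp_all
    \<comment> \<open>Consecutive hybrids become updates of one list at position \<open>k\<close>,
      the shape that monotonicity in a single argument requires.\<close>
    have old: "?zs[k := xs ! k] = ?zs"
      using k by (simp add: list_update_append upd_conv_take_nth_drop flip: Cons_nth_drop_Suc)
    have new: "?zs[k := ys ! k] = take (Suc k) ys @ drop (Suc k) xs"
      using k by (simp add: list_update_append take_Suc_conv_app_nth flip: Cons_nth_drop_Suc)
    have "mono (\<lambda>x. g (?zs[k := x]))"
      using mono k len len' by (simp add: mono_in_each_arg_def)
    moreover have "xs ! k \<le> ys ! k"
      using le k by (simp add: list_all2_nthD)
    ultimately have "g (?zs[k := xs ! k]) \<le> g (?zs[k := ys ! k])"
      by (rule monoD)
    then have "g ?zs \<le> g (take (Suc k) ys @ drop (Suc k) xs)"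
      unfolding old new .
    with Suc show ?case by (meson Suc_leD order_trans)
  qed
  from this[of n] show ?thesis
    using len len' by simp
qed

text \<open>The reduct freezes negated atoms at \<open>I\<close>, exactly as the second component of
  the pair \<open>(J, I)\<close> does.\<close>

lemma eval_reduct_formula: "eval F J (reduct_formula F I \<phi>) = eval_pair F (J, I) \<phi>"
  by (induction \<phi>) (auto cong: map_cong simp: comp_def)

text \<open>Knaster-Tarski: \<open>lfp f\<close> is the infimum of the prefixpoints of
  \<open>f\<close>, and monotonicity makes it a prefixpoint itself.\<close>

lemma is_least_model_iff_lfp:
  assumes "mono f" and "\<And>J. is_model F P J \<longleftrightarrow> f J \<le> J"
  shows "is_least_model F P I \<longleftrightarrow> lfp f = I"
proof
  assume "is_least_model F P I"
  then show "lfp f = I"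
    unfolding is_least_model_def assms(2)
    by (intro antisym lfp_lowerbound lfp_greatest) auto
next
  assume "lfp f = I"
  then show "is_least_model F P I"
    unfolding is_least_model_def assms(2)
    using lfp_fixpoint[OF assms(1)] lfp_lowerbound[of f] by auto
qed

context fuzzy_logic
begin

text \<open>Negated atoms read only the fixed \<open>U\<close>, so antimonotone negation does no
  harm; the connectives of a normal formula are all monotone.\<close>

lemma eval_pair_mono:
  assumes "normal_formula F \<phi>" and "L \<le> L'"
  shows "eval_pair F (L, U) \<phi> \<le> eval_pair F (L', U) \<phi>"
  using assms(1)
proof induction
  case (2 p)
  show ?case using assms(2) by (simp add: le_fun_def)
next
  case (4 f \<phi>s)
  have "mono_in_each_arg (arity F f) (truth_fun F f)"
    using 4(1) conjunctor_mono conjunctor_arity disjunctor_mono disjunctor_arity aggregator_mono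
    by auto
  then show ?case
    using 4 by (auto intro!: mono_in_each_arg_list_all2
      simp: list.rel_map list_all2_same)
qed simp_all

lemma T_lower_mono:
  assumes "normal_program F P"
  shows "mono (\<lambda>L. T_lower F P (L, U))"
proof (intro monoI le_funI)
  fix L L' :: "'a \<Rightarrow> 'v" and p
  assume "L \<le> L'"
  have "truth_fun F (adj F i) [w, eval_pair F (L, U) B]
      \<le> truth_fun F (adj F i) [w, eval_pair F (L', U) B]" if "Rule i w p B \<in> P" for i w B
  proof (rule mono_in_each_arg_list_all2)
    show "mono_in_each_arg 2 (truth_fun F (adj F i))"
      using assms that unfolding normal_program_def
      by (metis adj_conjunctor conjunctor_mono rule.sel(1))
    have "normal_formula F B"
      using assms that unfolding normal_program_def by (metis rule.sel(4))
    then show "list_all2 (\<le>) [w, eval_pair F (L, U) B] [w, eval_pair F (L', U) B]"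
      using \<open>L \<le> L'\<close> by (simp add: eval_pair_mono)
  qed simp
  then show "T_lower F P (L, U) p \<le> T_lower F P (L', U) p"
    unfolding T_lower_def by (intro Sup_mono) blast
qed

lemma is_model_reduct_iff:
  assumes "normal_program F P"
  shows "is_model F (reduct F P I) J \<longleftrightarrow> T_lower F P (J, I) \<le> J"
proof -
  have "is_model F (reduct F P I) J \<longleftrightarrow>
      (\<forall>r\<in>P. weight r \<le> truth_fun F (implicator r) [J (head r), eval_pair F (J, I) (body r)])"
    by (simp add: is_model_def reduct_def satisfies_def eval_reduct_formula)
  also have "\<dots> \<longleftrightarrow>
      (\<forall>r\<in>P. truth_fun F (adj F (implicator r)) [weight r, eval_pair F (J, I) (body r)]
        \<le> J (head r))"
    using assms by (auto simp: normal_program_def adjoint)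
  also have "\<dots> \<longleftrightarrow> T_lower F P (J, I) \<le> J"
  proof -
    \<comment> \<open>The supremum in \<open>T_lower\<close> at \<open>p\<close> ranges over rules
      in constructor form with head \<open>p\<close>, so the quantifier over rules is split to
      match.\<close>
    have "(\<forall>r\<in>P. Q r) \<longleftrightarrow> (\<forall>p i w B. Rule i w p B \<in> P \<longrightarrow> Q (Rule i w p B))"
      for Q :: "('s, 'v, 'a) rule \<Rightarrow> bool"
      by (metis rule.exhaust)
    then show ?thesis
      unfolding le_fun_def T_lower_def Sup_le_iff by (simp, blast)
  qed
  finally show ?thesis .
qed

end

theorem theorem7:
  fixes F :: "('s, 'v::complete_lattice) fuzzy_language"
    and P :: "('s, 'v, 'a) rule set"
    and I :: "'a \<Rightarrow> 'v"
  assumes "fuzzy_logic F"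
    and "normal_program F P"
  shows "aft_stable_model F P (I, I) \<longleftrightarrow> reduct_stable_model F P I"
proof -
  interpret fuzzy_logic F by fact
  \<comment> \<open>The second component of \<open>T_op\<close> swaps its arguments:
    \<open>snd (T_op F P (I, Y))\<close> is \<open>T_lower F P (Y, I)\<close>, so both least
    fixpoints belong to one operator.\<close>
  have "aft_stable_model F P (I, I) \<longleftrightarrow> lfp (\<lambda>J. T_lower F P (J, I)) = I"
    by (simp add: aft_stable_model_def T_stable_def T_op_def)
  also have "\<dots> \<longleftrightarrow> reduct_stable_model F P I"
    unfolding reduct_stable_model_def
    using is_least_model_iff_lfp[OF T_lower_mono is_model_reduct_iff] assms(2) by blast
  finally show ?thesis .
qed

end
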